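(* Let $p>23$ be a prime and let $f\in\mathbb{F}_p[x]$ be a non-constant polynomial. Regard $f$ as a function from $\mathbb{F}_p$ to the set of integers $\{0,1,\ldots,p-1\}$, and assume that $\sum_{x\in\mathbb{F}_p} f(x)=p$, where the sum is taken in $\mathbb{Z}$. Then $\deg(f)\ge \frac{p-1}{2}$.
   Context: $\mathbb{F}_p$ is the field with $p$ elements. Its elements are identified with the integers $\{0,1,\ldots,p-1\}$ (each element with its least non-negative representative); each value $f(x)$ is viewed as such an integer, so that the values of $f$ can be summed in $\mathbb{Z}$. *)

theory Defs
  imports "Berlekamp_Zassenhaus.Finite_Field"
begin

end

theory Submission
  imports Defs "Berlekamp_Zassenhaus.Berlekamp_Type_Based"
begin

text \<open>
  Let \<open>s\<close> be the product of the \<open>(X - x) ^ f(x)\<close> over all \<open>x\<close> in the field, the exponents being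
  taken as integers; it is monic of degree \<open>p\<close>.  The logarithmic derivative of \<open>s\<close> gives
  \<open>s' (X\<^sup>p - X) = - s f\<close>, so \<open>s'\<close> has the same degree as \<open>f\<close> and \<open>s = X\<^sup>p + g\<close> with
  \<open>deg g \<le> deg f + 1\<close>.  Hence \<open>X\<^sup>p (g' + f) = X g' - g f\<close>.  If \<open>2 deg f + 1 < p\<close>, then comparing
  degrees makes both sides vanish, so \<open>g' = - f\<close> and \<open>X g' = - g g'\<close>.  As \<open>f \<noteq> 0\<close>, this forces
  \<open>g = - X\<close>, and then \<open>f = 1\<close> is constant.
\<close>

lemma poly_prod_linear_remove:
  fixes x y :: "'a :: {finite, field}"
  assumes "x \<noteq> y"
  shows "poly (\<Prod>z\<in>UNIV - {x}. [:- z, 1:]) y = 0"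
  using assms by (auto simp: poly_prod)

text \<open>The products with one factor removed add up to the derivative of X^p - X, which is -1 in
  characteristic p. At \<open>x\<close> all the summands but its own vanish.\<close>

lemma poly_prod_linear_remove_self:
  fixes x :: "'a :: prime_card mod_ring"
  shows "poly (\<Prod>z\<in>UNIV - {x}. [:- z, 1:]) x = - 1"
proof -
  let ?E = "\<lambda>x :: 'a mod_ring. \<Prod>z\<in>UNIV - {x}. [:- z, 1:]"
  have "monom 1 CARD('a) - monom 1 1 = (\<Prod>z\<in>UNIV. [:- z, 1 :: 'a mod_ring:])"
    using poly_monom_identity_mod_p[where 'a = 'a] by simp
  then have "pderiv (monom 1 CARD('a) - monom 1 1 :: 'a mod_ring poly) = (\<Sum>x\<in>UNIV. ?E x)"
    by (simp add: pderiv_prod pderiv_pCons)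
  then have "- 1 = (\<Sum>x\<in>UNIV. ?E x)"
    by (simp add: pderiv_diff pderiv_monom monom_0 flip: one_pCons)
  then have "- 1 = (\<Sum>z\<in>UNIV. poly (?E z) x)"
    by (metis poly_sum poly_minus poly_1)
  also have "\<dots> = (\<Sum>z\<in>UNIV. if z = x then poly (?E x) x else 0)"
    by (intro sum.cong refl) (use poly_prod_linear_remove in auto)
  finally show ?thesis by simp
qed

text \<open>Multiplying by the linear factor avoids the exponent n - 1, so that n = 0 needs no
  exception when this is used for zeros of \<open>f\<close>.\<close>

lemma pderiv_linear_power_mult:
  fixes a :: "'a :: idom"
  shows "pderiv ([:- a, 1:] ^ n) * [:- a, 1:] = smult (of_nat n) ([:- a, 1:] ^ n)"
proof (cases n)
  case (Suc k)
  have "pderiv [:- a, 1:] = 1"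
    by (simp add: pderiv_pCons)
  then have "pderiv ([:- a, 1:] ^ n) = smult (of_nat n) ([:- a, 1:] ^ k)"
    by (simp only: Suc pderiv_power_Suc mult_1_right)
  then show ?thesis
    by (simp only: Suc mult_smult_left power_Suc2)
qed simp

lemma pderiv_prod_linear_power:
  fixes f :: "'a :: prime_card mod_ring poly"
  assumes "degree f < CARD('a)" and m: "\<And>x. of_nat (m x) = poly f x"
  defines "s \<equiv> \<Prod>x\<in>UNIV. [:- x, 1:] ^ m x"
  shows "pderiv s * (monom 1 CARD('a) - monom 1 1) = - (s * f)"
proof -
  let ?L = "\<lambda>x :: 'a mod_ring. [:- x, 1:]"
  let ?E = "\<lambda>x. \<Prod>z\<in>UNIV - {x}. ?L z"
  let ?R = "\<Sum>x\<in>UNIV. smult (of_nat (m x)) (?E x)"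
  have D: "monom 1 CARD('a) - monom 1 1 = ?L x * ?E x" for x
    using poly_monom_identity_mod_p[where 'a = 'a] prod.remove[of UNIV x ?L] by simp
  have "pderiv s * (monom 1 CARD('a) - monom 1 1)
      = (\<Sum>x\<in>UNIV. (\<Prod>z\<in>UNIV - {x}. ?L z ^ m z) * pderiv (?L x ^ m x)
          * (monom 1 CARD('a) - monom 1 1))"
    by (simp only: s_def pderiv_prod sum_distrib_right)
  \<comment> \<open>In the summand of \<open>x\<close>, X^p - X is split as
    \<open>?L x * ?E x\<close>; the factor \<open>?L x\<close> restores the power lowered by
    differentiation.\<close>
  also have "\<dots> = (\<Sum>x\<in>UNIV. s * smult (of_nat (m x)) (?E x))"
  proof (rule sum.cong[OF refl])
    fix x :: "'a mod_ring"
    have "(\<Prod>z\<in>UNIV - {x}. ?L z ^ m z) * pderiv (?L x ^ m x) * (?L x * ?E x)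
        = (\<Prod>z\<in>UNIV - {x}. ?L z ^ m z) * (pderiv (?L x ^ m x) * ?L x) * ?E x"
      by (simp only: mult_ac)
    also have "\<dots> = s * smult (of_nat (m x)) (?E x)"
      using prod.remove[of UNIV x "\<lambda>z. ?L z ^ m z"]
      by (simp only: pderiv_linear_power_mult s_def) (simp add: mult_ac)
    finally show "(\<Prod>z\<in>UNIV - {x}. ?L z ^ m z) * pderiv (?L x ^ m x)
        * (monom 1 CARD('a) - monom 1 1) = s * smult (of_nat (m x)) (?E x)"
      by (simp only: D[of x])
  qed
  also have "\<dots> = s * ?R"
    by (simp add: sum_distrib_left)
  \<comment> \<open>Lagrange interpolation: the basis polynomial \<open>?E x\<close> is -1 at
    \<open>x\<close> and 0 elsewhere, so both sides agree at all p points and have degree below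
    p.\<close>
  also have "?R = - f"
  proof (rule poly_eqI_degree)
    fix y
    have "poly ?R y = (\<Sum>x\<in>UNIV. if x = y then - poly f y else 0)"
      unfolding poly_sum
      using poly_prod_linear_remove[of _ y] poly_prod_linear_remove_self[of y]
      by (intro sum.cong refl) (auto simp: m)
    then show "poly ?R y = poly (- f) y" by simp
  next
    have "degree (?E x) = CARD('a) - 1" for x
      by (subst degree_prod_eq_sum_degree) (auto simp: card_Diff_singleton)
    then have "degree ?R \<le> CARD('a) - 1"
      by (intro degree_sum_le) (auto intro: order_trans[OF degree_smult_le])
    also have "\<dots> < card (UNIV :: 'a mod_ring set)"
      using nontriv[where 'a = 'a] by simp
    finally show "degree ?R < card (UNIV :: 'a mod_ring set)" .
  qed (use assms in simp)
  finally show ?thesis by simp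
qed

text \<open>A positive degree below p is nonzero in the field, so the leading term survives
  differentiation.\<close>

lemma degree_le_Suc_degree_pderiv_mod_ring:
  fixes g :: "'a :: prime_card mod_ring poly"
  assumes "degree g < CARD('a)"
  shows "degree g \<le> Suc (degree (pderiv g))"
proof (cases "degree g")
  case (Suc n)
  have "coeff g (Suc n) \<noteq> 0"
    using Suc by (metis leading_coeff_0_iff degree_0 nat.distinct(1))
  moreover have "(of_nat (Suc n) :: 'a mod_ring) \<noteq> 0"
    using assms Suc of_nat_0_mod_ring_dvd[where 'a = 'a, of "Suc n"] dvd_imp_le by fastforce
  ultimately have "coeff (pderiv g) n \<noteq> 0"
    by (simp add: coeff_pderiv del: of_nat_Suc)
  then show ?thesis
    using Suc le_degree by auto
qed simp

lemma lacunary_derivative_imp_constant: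
  fixes f g :: "'a :: prime_card mod_ring poly"
  assumes eq: "pderiv g * (monom 1 CARD('a) - monom 1 1) = - ((monom 1 CARD('a) + g) * f)"
    and "degree g \<le> Suc (degree f)" and "2 * degree f + 1 < CARD('a)"
  shows "degree f = 0"
proof -
  have split: "monom 1 CARD('a) * (pderiv g + f) = monom 1 1 * pderiv g - g * f"
    using eq by (simp add: algebra_simps)
  have "degree (monom 1 1 * pderiv g) \<le> 1 + degree (pderiv g)"
    by (rule order_trans[OF degree_mult_le]) (simp add: degree_monom_le)
  also have "\<dots> < CARD('a)"
    using assms degree_pderiv_le[of g] by linarith
  finally have "degree (monom 1 1 * pderiv g) < CARD('a)" .
  \<comment> \<open>The full strength of the degree bound is used here: deg g + deg f \<le> 2 deg f
    + 1.\<close>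
  moreover have "degree (g * f) < CARD('a)"
    using degree_mult_le[of g f] assms by linarith
  ultimately have "degree (monom 1 CARD('a) * (pderiv g + f)) < CARD('a)"
    unfolding split by (rule degree_diff_less)
  \<comment> \<open>A nonzero multiple of X^p would have degree at least p.\<close>
  then have g': "pderiv g + f = 0"
    by (metis degree_monom_eq degree_mult_eq le_add1 monom_eq_0_iff not_le zero_neq_one)
  then have "(monom 1 1 + g) * f = 0"
    using split by (simp add: eq_neg_iff_add_eq_0[symmetric] algebra_simps)
  then consider "f = 0" | "g = - monom 1 1"
    by (auto simp: eq_neg_iff_add_eq_0 add.commute)
  then show ?thesis
  proof cases
    case 2
    then have "f = monom 1 0"
      using g' by (simp add: pderiv_minus pderiv_monom)
    then show ?thesis by (simp add: degree_monom_eq)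
  qed simp
qed

theorem theorem1p1:
  fixes f :: "'a :: prime_card mod_ring poly" and p :: nat
  assumes "p = CARD('a)"
    and "p > 23"
    and "degree f > 0"
    and "(\<Sum>x\<in>UNIV. to_int_mod_ring (poly f x)) = int p"
  shows "real (degree f) \<ge> (real p - 1) / 2"
proof (rule ccontr)
  assume "\<not> ?thesis"
  then have "real (2 * degree f + 1) < real CARD('a)"
    using assms(1) by (simp add: field_simps)
  then have deg: "2 * degree f + 1 < CARD('a)"
    by (simp only: of_nat_less_iff)
  define m where "m x = nat (to_int_mod_ring (poly f x))" for x
  have int_m: "int (m x) = to_int_mod_ring (poly f x)" for x
    using range_to_int_mod_ring[where 'a = 'a] unfolding m_def by (metis atLeastLessThan_iff int_nat_eq rangeI)
  have m: "of_nat (m x) = poly f x" for x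
    by (simp add: of_nat_of_int_mod_ring int_m)
  have "int (\<Sum>x\<in>UNIV. m x) = int CARD('a)"
    using assms by (simp add: int_m)
  then have sum_m: "(\<Sum>x\<in>UNIV. m x) = CARD('a)"
    by linarith
  define s where "s = (\<Prod>x\<in>UNIV. [:- x, 1:] ^ m x)"
  define g where "g = s - monom 1 CARD('a)"
  have s_eq: "pderiv s * (monom 1 CARD('a) - monom 1 1) = - (s * f)"
    unfolding s_def by (rule pderiv_prod_linear_power) (use deg m in auto)
  \<comment> \<open>The degree is the sum of the multiplicities \<open>m x\<close>, which is p by
    the hypothesis on the values of \<open>f\<close>.\<close>
  have deg_s: "degree s = CARD('a)"
    unfolding s_def by (subst degree_prod_eq_sum_degree) (auto simp: degree_power_eq sum_m)
  have monic_s: "lead_coeff s = 1"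
    unfolding s_def by (simp add: lead_coeff_prod lead_coeff_power)
  have pderiv_g: "pderiv g = pderiv s"
    by (simp add: g_def pderiv_diff pderiv_monom)
  have "degree (monom 1 CARD('a) - monom 1 1 :: 'a mod_ring poly) = CARD('a)"
    using nontriv[where 'a = 'a]
      degree_add_eq_left[of "- monom 1 1" "monom 1 CARD('a) :: 'a mod_ring poly"]
    by (simp add: degree_monom_eq)
  moreover have "pderiv s \<noteq> 0" "s \<noteq> 0" "f \<noteq> 0"
    using s_eq assms(3) deg_s by auto
  \<comment> \<open>In \<open>s_eq\<close>, both X^p - X and \<open>s\<close> have degree p, and
    these contributions cancel.\<close>
  ultimately have deg_s': "degree (pderiv s) = degree f"
    using arg_cong[OF s_eq, of degree] deg_s
    by (subst (asm) degree_mult_eq) (auto simp: degree_mult_eq)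
  \<comment> \<open>Subtracting X^p removes the leading term of the monic \<open>s\<close>.\<close>
  have "degree g < CARD('a)"
  proof (intro degree_lessI allI impI)
    fix k assume "CARD('a) \<le> k"
    then show "coeff g k = 0"
      using monic_s deg_s by (cases "k = CARD('a)") (auto simp: g_def coeff_eq_0)
  qed simp
  then have "degree g \<le> Suc (degree f)"
    using degree_le_Suc_degree_pderiv_mod_ring[of g] by (simp add: pderiv_g deg_s')
  moreover have "pderiv g * (monom 1 CARD('a) - monom 1 1) = - ((monom 1 CARD('a) + g) * f)"
    using s_eq by (simp add: pderiv_g) (simp add: g_def)
  ultimately have "degree f = 0"
    using deg lacunary_derivative_imp_constant by blast
  then show False
    using assms(3) by simp
qed

end
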